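(* Let $q$ be any prime power and $A=\mathbb{F}_q[t]$. Then the following hold. (1) For all integers $n\ge 0$ and $k\ge 1$, $$\zeta(q^{n+k}-q^n,\ q^{n+k}-1)=\frac{[k]^{q^n}}{[n+k]}\,\zeta(q^{n+k}-1,\ q^{n+k}-q^n).$$ (2) Let $k\ge 1$ and $1\le s<q$ be integers, and let $k_1,\dots,k_s,l_1,\dots,l_s$ be integers with $0\le k_i,l_i<k$. Then $$\zeta\Big(q^k-\sum_{i=1}^s q^{k_i},\ sq^k-\sum_{i=1}^s q^{l_i}\Big)=\prod_{i=1}^s\frac{[k-k_i]^{q^{k_i}}}{[k-l_i]^{q^{l_i}}}\ \zeta\Big(q^k-\sum_{i=1}^s q^{l_i},\ sq^k-\sum_{i=1}^s q^{k_i}\Big).$$ (3) Let $k\ge 1$ and let $s_1,s_2$ be integers with $1\le s_1\le s_2\le q$ and $s_1\ne q$. Let $k_1,\dots,k_{s_1}$ and $l_1,\dots,l_{s_2}$ be integers with $0\le k_i<k$ and $0\le l_j<k$. Then $$\zeta\Big(q^k-\sum_{i=1}^{s_1} q^{k_i},\ s_2q^k-\sum_{j=1}^{s_2} q^{l_j}\Big)=\prod_{i=1}^{s_1}\frac{[k-k_i]^{q^{k_i}}}{[k-l_i]^{q^{l_i}}}\ \zeta\Big(q^k-\sum_{i=1}^{s_1} q^{l_i},\ s_2q^k-\sum_{j=1}^{s_1} q^{k_j}-\sum_{j=s_1+1}^{s_2} q^{l_j}\Big).$$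
   Context: $\mathbb{F}_q$ is a finite field with $q$ elements, $A=\mathbb{F}_q[t]$, $K=\mathbb{F}_q(t)$, and $K_\infty=\mathbb{F}_q((1/t))$ is the completion of $K$ at $\infty$. For an integer $n\ge 1$, $[n]:=t^{q^n}-t\in A$. For positive integers $s_1,s_2$, the depth-two multizeta value is $$\zeta(s_1,s_2):=\sum\frac{1}{a_1^{s_1}a_2^{s_2}}\in K_\infty,$$ where the sum runs over all pairs of monic polynomials $a_1,a_2\in A$ with $\deg a_1>\deg a_2\ge 0$. Equivalently, $\zeta(s_1,s_2)=\sum_{d\ge0}S_d(s_1)\sum_{0\le e<d}S_e(s_2)$, where $S_d(k)=\sum 1/a^k$ is the sum over monic $a\in A$ of degree $d$. *)

theory Defs
  imports
    "HOL-Computational_Algebra.Formal_Laurent_Series"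
    "HOL-Analysis.Infinite_Sum"
    "HOL-Library.Cardinality"
begin

text \<open>
  A finite field with \<open>q\<close> elements is a type \<open>'a :: {field, finite}\<close> with \<open>q = CARD('a)\<close>.
  Its polynomial ring is \<open>'a poly\<close>. The completion at infinity is \<open>'a fls\<close>, with its library
  metric, where the formal variable \<^term>\<open>fls_X\<close> stands for \<open>1/t\<close>; hence \<open>t\<close> is
  \<^term>\<open>fls_X_inv\<close>.
\<close>

definition poly_at_inf :: "'a::field poly \<Rightarrow> 'a fls" where
  "poly_at_inf p = poly (map_poly fls_const p) fls_X_inv"

definition bracket :: "nat \<Rightarrow> 'a::{field,finite} poly" where
  "bracket n = monom 1 (CARD('a) ^ n) - monom 1 1"

definition monic_pairs :: "('a::{field,finite} poly \<times> 'a poly) set" where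
  "monic_pairs = {(a1, a2). lead_coeff a1 = 1 \<and> lead_coeff a2 = 1 \<and> degree a2 < degree a1}"

text \<open>
  The sum below is unordered; it converges for all positive \<open>s1\<close> and \<open>s2\<close>, see
  \<open>zeta_summable\<close>.
\<close>

definition zeta :: "nat \<Rightarrow> nat \<Rightarrow> 'a::{field,finite} fls" where
  "zeta s1 s2 =
     (\<Sum>\<^sub>\<infinity>(a1, a2)\<in>monic_pairs. 1 / (poly_at_inf a1 ^ s1 * poly_at_inf a2 ^ s2))"

lemma poly_at_inf_sum:
  "poly_at_inf p = (\<Sum>i\<le>degree p. fls_const (coeff p i) * fls_X_inv ^ i)"
  by (simp add: poly_at_inf_def poly_altdef coeff_map_poly degree_map_poly)

lemma fls_nth_poly_at_inf:
  "fls_nth (poly_at_inf p) n = (if n \<le> 0 then coeff p (nat (- n)) else 0)"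
proof -
  have "fls_nth (poly_at_inf p) n
      = (\<Sum>i\<le>degree p. if n = - int i then coeff p i else 0)"
    unfolding poly_at_inf_sum fls_nth_sum
    by (intro sum.cong) (auto simp: fls_X_inv_power_conv_shift_1)
  also have "\<dots> = (\<Sum>i\<le>degree p. if i = nat (- n) \<and> n \<le> 0 then coeff p i else 0)"
    by (intro sum.cong) auto
  also have "\<dots> = (if n \<le> 0 then coeff p (nat (- n)) else 0)"
    by (auto simp: coeff_eq_0)
  finally show ?thesis .
qed

lemma poly_at_inf_eq_0_iff [simp]: "poly_at_inf p = 0 \<longleftrightarrow> p = 0"
proof
  assume "poly_at_inf p = 0"
  then have "fls_nth (poly_at_inf p) (- int (degree p)) = 0" by simp
  then show "p = 0" by (simp add: fls_nth_poly_at_inf)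
qed (simp add: poly_at_inf_def)

lemma fls_subdegree_poly_at_inf: "fls_subdegree (poly_at_inf p) = - int (degree p)"
proof (cases "p = 0")
  case False
  then show ?thesis
    by (intro fls_subdegree_eqI) (auto simp: fls_nth_poly_at_inf intro!: coeff_eq_0)
qed (simp add: poly_at_inf_def)

lemma finite_degree_le: "finite {p :: 'a::{field,finite} poly. degree p \<le> n}"
proof (rule finite_subset)
  show "{p :: 'a poly. degree p \<le> n} \<subseteq> Poly ` {xs. set xs \<subseteq> UNIV \<and> length xs \<le> Suc n}"
  proof
    fix p :: "'a poly" assume "p \<in> {p. degree p \<le> n}"
    then have "length (coeffs p) \<le> Suc n"
      by (cases "p = 0") (auto simp: length_coeffs_degree)
    then show "p \<in> Poly ` {xs. set xs \<subseteq> UNIV \<and> length xs \<le> Suc n}"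
      by (intro image_eqI[of _ _ "coeffs p"]) auto
  qed
qed (intro finite_imageI finite_lists_length_le, simp)

lemma dist_fls_less:
  fixes f g :: "'a::group_add fls"
  assumes "\<And>i. i \<le> int n \<Longrightarrow> fls_nth f i = fls_nth g i"
  shows "dist f g < inverse (2 ^ n)"
proof (cases "f = g")
  case False
  have "int (Suc n) \<le> fls_subdegree (f - g)"
    by (intro fls_subdegree_geI) (use False assms in auto)
  then have "n < nat (fls_subdegree (f - g))" and "0 \<le> fls_subdegree (f - g)"
    by linarith+
  then show ?thesis
    using False by (simp add: dist_fls_def)
qed simp

lemma fls_summable_on:
  fixes f :: "'b \<Rightarrow> 'a::field fls"
  assumes nonneg: "\<And>x. x \<in> S \<Longrightarrow> 0 \<le> fls_subdegree (f x)"
  assumes fin: "\<And>n. finite {x \<in> S. fls_subdegree (f x) \<le> int n}"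
  shows "f summable_on S"
proof -
  define T where "T n = {x \<in> S. fls_subdegree (f x) \<le> int n}" for n
  define L where
    "L = fps_to_fls (Abs_fps (\<lambda>n. \<Sum>x\<in>T n. fls_nth (f x) (int n)))"
  have eq: "fls_nth (sum f F) i = fls_nth L i"
    if F: "finite F" "T n \<subseteq> F" "F \<subseteq> S" and i: "i \<le> int n" for F n i
  proof (cases "i < 0")
    case True
    have "fls_nth (f x) i = 0" if "x \<in> F" for x
      using nonneg[of x] that F True by (intro fls_eq0_below_subdegree) auto
    then show ?thesis using True by (simp add: fls_nth_sum L_def)
  next
    case False
    have "T (nat i) \<subseteq> F" using F i False by (auto simp: T_def)
    moreover have "fls_nth (f x) i = 0" if "x \<in> F - T (nat i)" for x
      using that F False by (intro fls_eq0_below_subdegree) (auto simp: T_def)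
    ultimately have "(\<Sum>x\<in>F. fls_nth (f x) i) = (\<Sum>x\<in>T (nat i). fls_nth (f x) i)"
      using F by (intro sum.mono_neutral_right) auto
    then show ?thesis using False by (simp add: fls_nth_sum L_def)
  qed
  have "(f has_sum L) S"
    unfolding has_sum_def tendsto_iff eventually_finite_subsets_at_top
  proof (intro allI impI)
    fix e :: real assume "e > 0"
    then obtain n where n: "inverse (2 ^ n) < e"
      using real_arch_pow_inv[of e "1/2"] by (auto simp: field_simps)
    have "dist (sum f F) L < e" if "finite F" "T n \<subseteq> F" "F \<subseteq> S" for F
      using dist_fls_less[of n "sum f F" L] eq[OF that] n by fastforce
    then show "\<exists>X. finite X \<and> X \<subseteq> S \<and> (\<forall>Y. finite Y \<and> X \<subseteq> Y \<and> Y \<subseteq> S \<longrightarrow> dist (sum f Y) L < e)"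
      using fin by (intro exI[of _ "T n"]) (auto simp: T_def)
  qed
  then show ?thesis by (auto simp: summable_on_def)
qed

lemma zeta_summable:
  assumes "s1 > 0" "s2 > 0"
  shows "(\<lambda>(a1, a2). 1 / (poly_at_inf a1 ^ s1 * poly_at_inf a2 ^ s2))
           summable_on (monic_pairs :: ('a::{field,finite} poly \<times> 'a poly) set)"
proof -
  define f :: "'a poly \<times> 'a poly \<Rightarrow> 'a fls"
    where "f = (\<lambda>(a1, a2). 1 / (poly_at_inf a1 ^ s1 * poly_at_inf a2 ^ s2))"
  have sub: "fls_subdegree (f (a, b)) = int (s1 * degree a + s2 * degree b)"
    if "(a, b) \<in> monic_pairs" for a b
  proof -
    have "a \<noteq> 0" "b \<noteq> 0" using that by (auto simp: monic_pairs_def)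
    then show ?thesis
      by (simp add: f_def fls_divide_subdegree fls_subdegree_pow fls_subdegree_poly_at_inf)
  qed
  have fin: "finite {x \<in> monic_pairs. fls_subdegree (f x) \<le> int n}" for n
  proof (rule finite_subset)
    show "{x \<in> monic_pairs. fls_subdegree (f x) \<le> int n} \<subseteq> {a. degree a \<le> n} \<times> {b. degree b \<le> n}"
    proof clarify
      fix a b :: "'a poly"
      assume ab: "(a, b) \<in> monic_pairs" "fls_subdegree (f (a, b)) \<le> int n"
      then have le: "s1 * degree a + s2 * degree b \<le> n"
        by (simp only: sub of_nat_le_iff)
      have "degree a \<le> s1 * degree a" "degree b \<le> s2 * degree b" using assms by auto
      with le have "degree a \<le> n" "degree b \<le> n" by linarith+
      then show "a \<in> {a. degree a \<le> n} \<and> b \<in> {b. degree b \<le> n}" by blast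
    qed
  qed (intro finite_cartesian_product finite_degree_le)
  have "f summable_on monic_pairs"
    by (rule fls_summable_on) (use sub fin in auto)
  then show ?thesis by (simp add: f_def)
qed

text \<open>
  With these bounds, a natural-number subtraction \<open>q ^ k - (\<Sum>i=1..s. q ^ ks i)\<close> with \<open>s < q\<close>,
  or \<open>s * q ^ k - (\<Sum>i=1..s. q ^ ks i)\<close>, never truncates and has a positive result.
\<close>

lemma sum_powers_less:
  fixes q k s :: nat and ks :: "nat \<Rightarrow> nat"
  assumes "2 \<le> q" "1 \<le> k" "1 \<le> s" "\<forall>i\<in>{1..s}. ks i < k"
  shows "s < q \<Longrightarrow> (\<Sum>i=1..s. q ^ ks i) < q ^ k"
    and "(\<Sum>i=1..s. q ^ ks i) < s * q ^ k"
proof -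
  have "(\<Sum>i=1..s. q ^ ks i) \<le> (\<Sum>i=1..s. q ^ (k - 1))"
    using assms by (intro sum_mono power_increasing) (fastforce dest: bspec)+
  then have le: "(\<Sum>i=1..s. q ^ ks i) \<le> s * q ^ (k - 1)" by simp
  have k: "q ^ k = q * q ^ (k - 1)" "0 < q ^ (k - 1)"
    using assms by (auto simp flip: power_Suc)
  show "(\<Sum>i=1..s. q ^ ks i) < q ^ k" if "s < q"
    using le k that by (metis le_less_trans mult_less_mono1)
  have "s * q ^ (k - 1) < s * q ^ k"
    using assms by (intro mult_strict_left_mono power_strict_increasing) auto
  with le show "(\<Sum>i=1..s. q ^ ks i) < s * q ^ k" by (rule le_less_trans)
qed

end

theory Submission
  imports Defs
begin

text \<open>
  Put \<open>T = t^(q^k)\<close>. For a polynomial \<open>a\<close> we have \<open>a(t)^(q^i) = a(t^(q^i))\<close>, so interpolating \<open>a\<close>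
  at the nodes \<open>T, T^q, \<dots>, T^(q^(d-1))\<close>, where it takes the values \<open>a(T)^(q^j)\<close>, writes
  \<open>a(t)^(q^i)\<close> as a \<open>q\<close>-polynomial in \<open>a(T)\<close> if \<open>deg a < d\<close>, and as such a \<open>q\<close>-polynomial plus
  the constant \<open>w(t^(q^i))\<close> with \<open>w(u) = \<Prod>\<^sub>j (u - T^(q^j))\<close> if \<open>a\<close> is monic of degree \<open>d\<close>.
  Hence the power sums are sums over all \<open>a(T)\<close> of a polynomial in \<open>a(T)\<close> of low degree (divided by
  \<open>a(T)\<close> in the monic case), and Lagrange interpolation at \<open>0\<close> evaluates them as products: with
  \<open>\<lambda>\<close> the Lagrange basis polynomial of the node \<open>T\<close>,
  \<open>S\<^sub>d(q^k - \<Sum> q^(k\<^sub>i))\<close> is \<open>S\<^sub>d(q^k)\<close> times the product of the \<open>w(t^(q^(k\<^sub>i)))\<close>, and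
  \<open>\<Sum>\<^bsub>e < d\<^esub> S\<^sub>e(s q^k - \<Sum> q^(l\<^sub>j))\<close> is the product of the \<open>\<lambda>(t^(q^(l\<^sub>j)))\<close>.
  As \<open>w(u)\<close> is a constant times \<open>(u - T) \<lambda>(u)\<close>, exchanging \<open>k\<^sub>i\<close> and \<open>l\<^sub>i\<close> only changes the
  factors \<open>t^(q^(k\<^sub>i)) - T = - [k - k\<^sub>i]^(q^(k\<^sub>i))\<close>, for every \<open>d\<close>.
\<close>

section \<open>Lagrange interpolation and sums over additive subgroups and their cosets\<close>

text \<open>The degree bound is put on coefficients so that it also covers an empty
  \<open>I\<close>, where it forces \<open>f = 0\<close>. Nodes form an indexed family, to serve
  both for the nodes \<open>node (k + j)\<close> and for sets whose elements are themselves the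
  nodes.\<close>

lemma lagrange_interpolation:
  fixes f :: "'b::field poly" and x :: "'i \<Rightarrow> 'b"
  assumes fin: "finite I" and inj: "inj_on x I" and deg: "\<And>n. n \<ge> card I \<Longrightarrow> coeff f n = 0"
  shows "poly f u = (\<Sum>i\<in>I. poly f (x i) * (\<Prod>j\<in>I - {i}. (u - x j) / (x i - x j)))"
proof (cases "I = {}")
  case True
  then have "f = 0" using deg by (intro poly_eqI) auto
  then show ?thesis using True by simp
next
  case False
  define L where "L i = smult (poly f (x i) / (\<Prod>j\<in>I - {i}. x i - x j)) (\<Prod>j\<in>I - {i}. [:- x j, 1:])" for i
  have pos: "card I > 0" using False fin by (simp add: card_gt_0_iff)
  have poly_L: "poly (L i) u = poly f (x i) * (\<Prod>j\<in>I - {i}. (u - x j) / (x i - x j))" for i u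
    by (simp add: L_def poly_prod prod_dividef)
  have degL: "degree (L i) \<le> card I - 1" if "i \<in> I" for i
  proof -
    have "degree (\<Prod>j\<in>I - {i}. [:- x j, 1:]) \<le> (\<Sum>j\<in>I - {i}. 1)"
      by (rule order.trans[OF degree_prod_sum_le]) (use fin in auto)
    then show ?thesis using that fin by (auto simp: L_def intro: order.trans[OF degree_smult_le])
  qed
  have "f = (\<Sum>i\<in>I. L i)"
  proof (rule poly_eqI_degree)
    fix y assume "y \<in> x ` I"
    then obtain k where k: "k \<in> I" "y = x k" by auto
    have "poly (\<Sum>i\<in>I. L i) y = (\<Sum>i\<in>I. if i = k then poly f y else 0)"
      unfolding poly_sum
    proof (intro sum.cong refl)
      fix i assume i: "i \<in> I"
      show "poly (L i) y = (if i = k then poly f y else 0)"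
      proof (cases "i = k")
        case True
        have "x k \<noteq> x j" if "j \<in> I - {k}" for j
          using inj k that by (auto simp: inj_on_def)
        then have "(\<Prod>j\<in>I - {k}. (x k - x j) / (x k - x j)) = 1" by (intro prod.neutral) auto
        then show ?thesis using True k by (simp add: poly_L)
      next
        case False
        then have "(\<Prod>j\<in>I - {i}. (x k - x j) / (x i - x j)) = 0"
          using k fin by (intro prod_zero bexI[of _ k]) auto
        then show ?thesis using False k by (simp add: poly_L)
      qed
    qed
    then show "poly f y = poly (\<Sum>i\<in>I. L i) y" using k fin by simp
  next
    have "degree f \<le> card I - 1"
      using deg by (intro degree_le) auto
    then show "degree f < card (x ` I)" using pos by (simp add: card_image[OF inj])
    have "degree (\<Sum>i\<in>I. L i) \<le> card I - 1"
      by (rule degree_sum_le[OF fin degL])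
    then show "degree (\<Sum>i\<in>I. L i) < card (x ` I)" using pos by (simp add: card_image[OF inj])
  qed
  then have "poly f u = poly (\<Sum>i\<in>I. L i) u" by simp
  then show ?thesis by (simp add: poly_sum poly_L)
qed

text \<open>Interpolate \<open>f\<close> at the \<open>card V - 1\<close> nonzero elements of
  \<open>V\<close> and evaluate at 0: every Lagrange weight is \<open>-1\<close>, because negation
  and the maps \<open>w \<mapsto> v - w\<close> permute \<open>V\<close>. The number of nodes
  explains the bound on \<open>degree f + 1\<close>.\<close>

lemma sum_poly_nonzero_subgroup:
  fixes V :: "'b::field set"
  assumes fin: "finite V" and zero: "0 \<in> V" and diff: "\<And>v w. v \<in> V \<Longrightarrow> w \<in> V \<Longrightarrow> v - w \<in> V"
    and deg: "degree f + 1 < card V"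
  shows "(\<Sum>v\<in>V - {0}. poly f v) = - poly f 0"
proof -
  define C where "C = \<Prod>(V - {0})"
  have neg: "- v \<in> V" if "v \<in> V" for v using diff[OF zero that] by simp
  have C0: "C \<noteq> 0" using fin by (simp add: C_def)
  have w: "(\<Prod>w\<in>V - {0} - {v}. (0 - w) / (v - w)) = - 1" if v: "v \<in> V - {0}" for v
  proof -
    have "(\<Prod>w\<in>V - {0}. - w) = C"
      unfolding C_def by (rule prod.reindex_bij_witness[of _ uminus uminus]) (auto intro: neg)
    then have num: "- v * (\<Prod>w\<in>V - {0} - {v}. - w) = C"
      using prod.remove[of "V - {0}" v "\<lambda>w. - w"] v fin by simp
    \<comment> \<open>The map \<open>w \<mapsto> v - w\<close> sends \<open>V - {v}\<close> onto
      \<open>V - {0}\<close>. The factor for \<open>w = 0\<close> is \<open>v\<close>; splitting it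
      off leaves the denominator of the weight.\<close>
    have "(\<Prod>w\<in>V - {v}. v - w) = C"
      unfolding C_def
    proof (rule prod.reindex_bij_witness[of _ "\<lambda>w. v - w" "\<lambda>w. v - w"])
      fix a assume "a \<in> V - {v}" then show "v - a \<in> V - {0}" using v diff by auto
    next
      fix a assume "a \<in> V - {0}" then show "v - a \<in> V - {v}" using v diff by auto
    qed auto
    moreover have "V - {v} - {0} = V - {0} - {v}" by auto
    ultimately have den: "v * (\<Prod>w\<in>V - {0} - {v}. v - w) = C"
      using prod.remove[of "V - {v}" 0 "\<lambda>w. v - w"] v fin zero
      by simp
    have "(\<Prod>w\<in>V - {0} - {v}. (0 - w) / (v - w)) = (\<Prod>w\<in>V - {0} - {v}. - w) / (\<Prod>w\<in>V - {0} - {v}. v - w)"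
      by (subst prod_dividef) simp
    also have "(\<Prod>w\<in>V - {0} - {v}. - w) = - C / v" using num v by (auto simp: field_simps)
    also have "(\<Prod>w\<in>V - {0} - {v}. v - w) = C / v" using den v by (auto simp: field_simps)
    finally show ?thesis using C0 v by simp
  qed
  have "poly f 0 = (\<Sum>v\<in>V - {0}. poly f v * (\<Prod>w\<in>V - {0} - {v}. (0 - w) / (v - w)))"
    by (rule lagrange_interpolation[where x = "\<lambda>v. v"])
       (use fin zero deg in \<open>auto simp: card_Diff_singleton intro!: coeff_eq_0\<close>)
  also have "\<dots> = (\<Sum>v\<in>V - {0}. poly f v * - 1)"
    by (intro sum.cong refl) (simp only: w)
  also have "\<dots> = - (\<Sum>v\<in>V - {0}. poly f v)"
    by (simp add: sum_negf)
  finally show ?thesis by simp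
qed

text \<open>Interpolate at the points of the coset, which avoids 0 since
  \<open>z \<notin> V\<close>. The differences \<open>v - w\<close> with \<open>w \<noteq> v\<close>
  run through \<open>V - {0}\<close>, so the weight of \<open>v\<close> at 0 is a constant, the same
  for all \<open>v\<close>, divided by \<open>v\<close>.\<close>

lemma sum_poly_divide_coset:
  fixes V :: "'b::field set"
  assumes fin: "finite V" and zero: "0 \<in> V" and diff: "\<And>v w. v \<in> V \<Longrightarrow> w \<in> V \<Longrightarrow> v - w \<in> V"
    and z: "z \<notin> V" and deg: "degree f < card V"
  shows "(\<Sum>w\<in>(+) z ` V. poly f w / w) = (\<Sum>w\<in>(+) z ` V. 1 / w) * poly f 0"
proof -
  define W where "W = (+) z ` V"
  define C where "C = \<Prod>(V - {0})"
  define N where "N = (\<Prod>w\<in>W. - w)"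
  have neg: "- v \<in> V" if "v \<in> V" for v using diff[OF zero that] by simp
  have finW: "finite W" and cardW: "card W = card V"
    using fin by (auto simp: W_def card_image)
  have W0: "0 \<notin> W" using z neg[of "- z"] by (auto simp: W_def add_eq_0_iff)
  have C0: "C \<noteq> 0" using fin by (simp add: C_def)
  have N0: "N \<noteq> 0" using finW W0 by (auto simp: N_def)
  have lag: "poly g 0 = - N / C * (\<Sum>w\<in>W. poly g w / w)" if "degree g < card V" for g
  proof -
    have w: "(\<Prod>w\<in>W - {v}. (0 - w) / (v - w)) = - N / C / v" if v: "v \<in> W" for v
    proof -
      have v0: "v \<noteq> 0" using v W0 by auto
      have "N = - v * (\<Prod>w\<in>W - {v}. - w)"
        unfolding N_def by (rule prod.remove[OF finW v])
      then have num: "(\<Prod>w\<in>W - {v}. - w) = - N / v" using v0 by (simp add: field_simps)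
      have den: "(\<Prod>w\<in>W - {v}. v - w) = C"
        unfolding C_def
      proof (rule prod.reindex_bij_witness[of _ "\<lambda>w. v - w" "\<lambda>w. v - w"])
        fix a assume "a \<in> W - {v}" then show "v - a \<in> V - {0}" using v diff by (auto simp: W_def)
      next
        fix a assume a: "a \<in> V - {0}"
        obtain v' where "v' \<in> V" "v = z + v'" using v by (auto simp: W_def)
        then have "v - a = z + (v' - a)" "v' - a \<in> V" using a diff by auto
        then show "v - a \<in> W - {v}" using a by (auto simp: W_def)
      qed auto
      show ?thesis by (subst prod_dividef) (simp add: num den)
    qed
    have "poly g 0 = (\<Sum>v\<in>W. poly g v * (\<Prod>w\<in>W - {v}. (0 - w) / (v - w)))"
      by (rule lagrange_interpolation[where x = "\<lambda>v. v"])
         (use finW that in \<open>auto simp: cardW intro!: coeff_eq_0\<close>)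
    also have "\<dots> = (\<Sum>v\<in>W. poly g v * (- N / C / v))"
      by (intro sum.cong refl) (simp only: w)
    finally show ?thesis by (simp add: sum_distrib_left field_simps sum_negf)
  qed
  \<comment> \<open>The constant polynomial 1 identifies the common constant as the inverse of the
    sum of the \<open>1 / w\<close>.\<close>
  have "1 = - N / C * (\<Sum>w\<in>W. 1 / w)" using lag[of 1] deg by simp
  with lag[OF deg] N0 C0 show ?thesis by (simp add: W_def field_simps)
qed

section \<open>Frobenius powers of Laurent series and of polynomial values\<close>

lemma two_le_CARD_field: "2 \<le> CARD('a::{field,finite})"
proof -
  have "card {0::'a, 1} \<le> CARD('a)" by (intro card_mono) auto
  then show ?thesis by simp
qed

text \<open>Translation by 1 permutes the ring, so adding 1 to every element does not change the sum
  of all elements.\<close>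

lemma of_nat_CARD_eq_0: "of_nat CARD('a) = (0 :: 'a::{ring_1,finite})"
proof -
  have "(\<Sum>x\<in>UNIV. x) = (\<Sum>x\<in>UNIV. x + (1::'a))"
    by (rule sum.reindex_bij_witness[of _ "\<lambda>x. x + 1" "\<lambda>x. x - 1"]) auto
  then show ?thesis by (simp add: sum.distrib)
qed

lemma power_CARD_eq_self: "(x :: 'a::{field,finite}) ^ CARD('a) = x"
proof (cases "x = 0")
  case False
  have "(\<Prod>y\<in>UNIV - {0}. x * y) = (\<Prod>y\<in>UNIV - {0}. y)"
    by (rule prod.reindex_bij_witness[of _ "\<lambda>y. y / x" "\<lambda>y. x * y"]) (use False in auto)
  then have "x ^ (CARD('a) - 1) = 1"
    by (simp add: prod.distrib card_Diff_singleton)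
  then have "x * x ^ (CARD('a) - 1) = x" by simp
  then show ?thesis
    using two_le_CARD_field[where ?'a = 'a] by (simp flip: power_Suc)
qed (use two_le_CARD_field[where ?'a = 'a] in simp)

text \<open>
  For fixed \<open>y \<noteq> 0\<close> the polynomial \<open>(X + y)^q - X^q - y^q\<close> has degree less than \<open>q\<close> and vanishes
  at the \<open>q\<close> points \<open>c y\<close> with \<open>c\<close> in the finite field.
\<close>
lemma fls_add_power_CARD:
  fixes x y :: "'a::{field,finite} fls"
  shows "(x + y) ^ CARD('a) = x ^ CARD('a) + y ^ CARD('a)"
proof (cases "y = 0")
  case False
  define q where "q = CARD('a)"
  have q: "q \<ge> 2" using two_le_CARD_field[where ?'a = 'a] by (simp add: q_def)
  define P where "P = [:y, 1:] ^ q - monom 1 q - [:y ^ q:]"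
  have "degree ([:y, 1:] ^ q - monom 1 q) < q"
  proof (rule degree_lessI)
    show "[:y, 1:] ^ q - monom 1 q \<noteq> 0 \<or> q > 0" using q by simp
    show "\<forall>n\<ge>q. coeff ([:y, 1:] ^ q - monom 1 q) n = 0"
    proof (intro allI impI)
      fix n assume n: "n \<ge> q"
      have d: "degree ([:y, 1:] ^ q) = q" by (simp add: degree_power_eq)
      have "lead_coeff ([:y, 1:] ^ q) = 1" by (subst lead_coeff_power) simp
      then show "coeff ([:y, 1:] ^ q - monom 1 q) n = 0"
        using n d by (cases "n = q") (auto simp: coeff_eq_0)
    qed
  qed
  then have deg: "degree P < q"
    unfolding P_def by (rule degree_diff_less) (use q in auto)
  have "P = 0"
  proof (rule poly_eqI_degree)
    fix z assume "z \<in> (\<lambda>c. fls_const c * y) ` UNIV"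
    then obtain c where c: "z = fls_const c * y" by auto
    have "z + y = fls_const (c + 1) * y"
      by (simp add: c algebra_simps flip: fls_plus_const)
    then have "(z + y) ^ q = fls_const (c + 1) * y ^ q"
      by (simp add: power_mult_distrib power_CARD_eq_self q_def flip: fls_const_power)
    also have "\<dots> = z ^ q + y ^ q"
      by (simp add: c power_mult_distrib power_CARD_eq_self q_def algebra_simps
            flip: fls_const_power fls_plus_const)
    finally have "(z + y) ^ q = z ^ q + y ^ q" .
    then show "poly P z = poly 0 z" by (simp add: P_def poly_monom add.commute)
  next
    have "inj (\<lambda>c. fls_const c * y)"
      using False by (auto simp: inj_def fls_eq_iff)
    then have "card (range (\<lambda>c. fls_const c * y)) = q" by (simp add: card_image q_def)
    then show "degree P < card (range (\<lambda>c. fls_const c * y))"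
      and "degree (0::'a fls poly) < card (range (\<lambda>c. fls_const c * y))"
      using deg q by auto
  qed
  then have "poly P x = 0" by simp
  then show ?thesis by (simp add: P_def poly_monom q_def algebra_simps)
qed (use two_le_CARD_field[where ?'a = 'a] in simp)

text \<open>The \<open>q\<close>-th power is additive and fixes the coefficients, so it acts on the
  argument alone.\<close>

lemma poly_map_fls_const_power_CARD:
  fixes a :: "'a::{field,finite} poly"
  shows "poly (map_poly fls_const a) u ^ CARD('a) = poly (map_poly fls_const a) (u ^ CARD('a))"
proof (induction a)
  case 0
  then show ?case using two_le_CARD_field[where ?'a = 'a] by simp
next
  case (pCons c a)
  then show ?case
    by (simp add: map_poly_pCons fls_add_power_CARD power_mult_distrib power_CARD_eq_self
          flip: fls_const_power)
qed

lemma poly_at_inf_power_CARD: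
  fixes a :: "'a::{field,finite} poly"
  shows "poly_at_inf a ^ (CARD('a) ^ i) = poly (map_poly fls_const a) (fls_X_inv ^ (CARD('a) ^ i))"
proof (induction i)
  case (Suc i)
  have "poly_at_inf a ^ (CARD('a) ^ Suc i) = (poly_at_inf a ^ (CARD('a) ^ i)) ^ CARD('a)"
    by (simp only: power_Suc mult.commute[of "CARD('a)"] power_mult)
  also have "\<dots> = poly (map_poly fls_const a) ((fls_X_inv ^ (CARD('a) ^ i)) ^ CARD('a))"
    by (simp only: Suc poly_map_fls_const_power_CARD)
  also have "(fls_X_inv ^ (CARD('a) ^ i)) ^ CARD('a) = (fls_X_inv :: 'a fls) ^ (CARD('a) ^ Suc i)"
    by (simp only: power_Suc mult.commute[of "CARD('a)"] power_mult)
  finally show ?case .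
qed (simp add: poly_at_inf_def)

lemma poly_at_inf_add: "poly_at_inf (a + b) = poly_at_inf a + poly_at_inf b"
  by (intro fls_eqI) (simp add: fls_nth_poly_at_inf)

lemma poly_at_inf_diff: "poly_at_inf (a - b) = poly_at_inf a - poly_at_inf b"
  by (intro fls_eqI) (simp add: fls_nth_poly_at_inf)

lemma poly_at_inf_smult: "poly_at_inf (smult c a) = fls_const c * poly_at_inf a"
  by (intro fls_eqI) (simp add: fls_nth_poly_at_inf)

lemma poly_at_inf_bracket:
  "poly_at_inf (bracket n :: 'a::{field,finite} poly) = fls_X_inv ^ (CARD('a) ^ n) - fls_X_inv"
  unfolding bracket_def poly_at_inf_diff by (simp add: poly_at_inf_def map_poly_monom poly_monom)

lemma fls_power_CARD_add:
  fixes x y :: "'a::{field,finite} fls"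
  shows "(x + y) ^ (CARD('a) ^ i) = x ^ (CARD('a) ^ i) + y ^ (CARD('a) ^ i)"
  by (induction i) (simp_all only: power_0 power_one_right power_Suc mult.commute[of "CARD('a)"]
        power_mult fls_add_power_CARD)

lemma fls_power_CARD_diff:
  fixes x y :: "'a::{field,finite} fls"
  shows "(x - y) ^ (CARD('a) ^ i) = x ^ (CARD('a) ^ i) - y ^ (CARD('a) ^ i)"
  using fls_power_CARD_add[of "x - y" y i] by simp

lemma fls_const_power_CARD:
  "fls_const (c :: 'a::{field,finite}) ^ (CARD('a) ^ i) = fls_const c"
  by (induction i) (simp_all only: power_0 power_one_right power_Suc mult.commute[of "CARD('a)"]
        power_mult power_CARD_eq_self flip: fls_const_power)

text \<open>The value \<open>a(t^(q^k))\<close>, see \<open>poly_at_inf_power_CARD\<close>.\<close>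
definition frob_at_inf :: "nat \<Rightarrow> 'a::{field,finite} poly \<Rightarrow> 'a fls" where
  "frob_at_inf k a = poly_at_inf a ^ (CARD('a) ^ k)"

lemma frob_at_inf_add: "frob_at_inf k (a + b) = frob_at_inf k a + frob_at_inf k b"
  by (simp add: frob_at_inf_def poly_at_inf_add fls_power_CARD_add)

lemma frob_at_inf_diff: "frob_at_inf k (a - b) = frob_at_inf k a - frob_at_inf k b"
  by (simp add: frob_at_inf_def poly_at_inf_diff fls_power_CARD_diff)

lemma frob_at_inf_smult: "frob_at_inf k (smult c a) = fls_const c * frob_at_inf k a"
  by (simp add: frob_at_inf_def poly_at_inf_smult power_mult_distrib fls_const_power_CARD)

lemma frob_at_inf_eq_0_iff [simp]: "frob_at_inf k a = 0 \<longleftrightarrow> a = 0"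
  by (simp add: frob_at_inf_def)

lemma inj_frob_at_inf: "inj (frob_at_inf k)"
proof (rule injI)
  fix a b :: "'a poly" assume "frob_at_inf k a = frob_at_inf k b"
  then have "frob_at_inf k (a - b) = 0" by (simp add: frob_at_inf_diff)
  then show "a = b" by simp
qed

section \<open>Polynomials of bounded degree and monic polynomials\<close>

text \<open>Defined by coefficients because \<open>degree 0 = 0\<close>: the zero polynomial has to
  belong to \<open>deg_less 0\<close> as well, so that there are \<open>q ^ d\<close> elements for
  every \<open>d\<close>.\<close>

definition deg_less :: "nat \<Rightarrow> 'a::zero poly set" where
  "deg_less d = {a. \<forall>n\<ge>d. coeff a n = 0}"

definition monics :: "nat \<Rightarrow> 'a::comm_semiring_1 poly set" where
  "monics d = {a. lead_coeff a = 1 \<and> degree a = d}"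

definition monics_less :: "nat \<Rightarrow> 'a::comm_semiring_1 poly set" where
  "monics_less d = {a. lead_coeff a = 1 \<and> degree a < d}"

lemma card_deg_less: "card (deg_less d :: 'a::{zero,finite} poly set) = CARD('a) ^ d"
proof (induction d)
  case 0
  have "deg_less 0 = {0 :: 'a poly}" by (auto simp: deg_less_def intro: poly_eqI)
  then show ?case by simp
next
  case (Suc d)
  have "bij_betw (\<lambda>(c, a). pCons c a) (UNIV \<times> deg_less d) (deg_less (Suc d) :: 'a poly set)"
  proof (rule bij_betw_byWitness[where f' = "\<lambda>a. (coeff a 0, poly_shift 1 a)"])
    show "\<forall>a\<in>deg_less (Suc d). (\<lambda>(c, a). pCons c a) (coeff a 0, poly_shift 1 a) = (a :: 'a poly)"
      by (auto simp: poly_eq_iff coeff_pCons coeff_poly_shift split: nat.split)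
  qed (auto simp: deg_less_def coeff_pCons coeff_poly_shift poly_eq_iff split: nat.split)
  from bij_betw_same_card[OF this] show ?case
    by (simp add: card_cartesian_product Suc)
qed

lemma finite_deg_less [simp]: "finite (deg_less d :: 'a::{zero,finite} poly set)"
  using card_deg_less[of d, where ?'a = 'a] by (intro card_ge_0_finite) (simp add: card_gt_0_iff)

lemma monics_eq_image: "monics d = (+) (monom 1 d) ` (deg_less d :: 'a::comm_ring_1 poly set)"
proof (intro equalityI subsetI)
  fix a :: "'a poly" assume "a \<in> monics d"
  then have "a - monom 1 d \<in> deg_less d"
    by (auto simp: monics_def deg_less_def coeff_eq_0)
  then show "a \<in> (+) (monom 1 d) ` deg_less d"
    by (intro image_eqI[of _ _ "a - monom 1 d"]) auto
next
  fix a :: "'a poly" assume "a \<in> (+) (monom 1 d) ` deg_less d"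
  then have a: "coeff a d = 1" "\<And>n. n > d \<Longrightarrow> coeff a n = 0"
    by (auto simp: deg_less_def)
  then have "degree a = d"
    by (intro antisym degree_le le_degree) auto
  with a show "a \<in> monics d" by (simp add: monics_def)
qed

lemma finite_monics [simp]: "finite (monics d :: 'a::{comm_ring_1,finite} poly set)"
  by (simp add: monics_eq_image)

lemma finite_monics_less [simp]: "finite (monics_less d :: 'a::{comm_ring_1,finite} poly set)"
  by (rule finite_subset[OF _ finite_deg_less[of d]]) (auto simp: monics_less_def deg_less_def coeff_eq_0)

section \<open>Interpolation at the nodes \<open>t ^ (q ^ i)\<close>\<close>

definition node :: "nat \<Rightarrow> 'a::{field,finite} fls" where
  "node i = fls_X_inv ^ (CARD('a) ^ i)"

text \<open>The subdegrees \<open>- (q ^ i)\<close> are distinct because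
  \<open>q \<ge> 2\<close>.\<close>

lemma inj_node: "inj (node :: nat \<Rightarrow> 'a::{field,finite} fls)"
proof (rule injI)
  fix i j assume "node i = (node j :: 'a fls)"
  then have "fls_subdegree (node i :: 'a fls) = fls_subdegree (node j :: 'a fls)" by simp
  then have "CARD('a) ^ i = CARD('a) ^ j"
    by (simp add: node_def fls_subdegree_pow del: power_inject_exp flip: of_nat_power)
  then show "i = j" using two_le_CARD_field[where ?'a = 'a] by simp
qed

text \<open>The power \<open>q ^ i\<close> distributes over the difference defining the bracket.
  This turns the factors of the theorem into differences of nodes.\<close>

lemma poly_at_inf_bracket_power:
  assumes "i \<le> k"
  shows "poly_at_inf (bracket (k - i)) ^ (CARD('a) ^ i) = (node k - node i :: 'a::{field,finite} fls)"
  using assms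
  by (simp add: poly_at_inf_bracket fls_power_CARD_diff node_def flip: power_mult power_add)

text \<open>For \<open>j = 0\<close> this is the function \<open>\<lambda>\<close> of the overview;
  \<open>node_prod k d\<close> is its \<open>w\<close>.\<close>

definition lagrange_basis :: "nat \<Rightarrow> nat \<Rightarrow> nat \<Rightarrow> 'a::{field,finite} fls \<Rightarrow> 'a fls" where
  "lagrange_basis k d j u = (\<Prod>m\<in>{..<d} - {j}. (u - node (k + m)) / (node (k + j) - node (k + m)))"

definition node_prod :: "nat \<Rightarrow> nat \<Rightarrow> 'a::{field,finite} fls \<Rightarrow> 'a fls" where
  "node_prod k d u = (\<Prod>m<d. u - node (k + m))"

lemma interpolate_at_nodes:
  fixes f :: "'a::{field,finite} fls poly"
  assumes "\<And>n. n \<ge> d \<Longrightarrow> coeff f n = 0"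
  shows "poly f u = (\<Sum>j<d. poly f (node (k + j)) * lagrange_basis k d j u)"
  unfolding lagrange_basis_def
  by (rule lagrange_interpolation)
     (use assms in \<open>auto intro!: inj_onI dest: injD[OF inj_node]\<close>)

lemma poly_map_fls_const_node: "poly (map_poly fls_const a) (node i) = frob_at_inf i a"
  by (simp add: node_def frob_at_inf_def poly_at_inf_power_CARD)

lemma frob_at_inf_add_exponent:
  "frob_at_inf (k + j) (a :: 'a::{field,finite} poly) = frob_at_inf k a ^ (CARD('a) ^ j)"
  by (simp add: frob_at_inf_def power_add power_mult)

lemma frob_at_inf_eq_deg_less:
  fixes a :: "'a::{field,finite} poly"
  assumes "a \<in> deg_less d"
  shows "frob_at_inf i a = (\<Sum>j<d. frob_at_inf k a ^ (CARD('a) ^ j) * lagrange_basis k d j (node i))"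
  using interpolate_at_nodes[of d "map_poly fls_const a" "node i" k] assms
  by (simp add: poly_map_fls_const_node frob_at_inf_add_exponent deg_less_def coeff_map_poly)

lemma frob_at_inf_eq_monics:
  fixes a :: "'a::{field,finite} poly"
  assumes "a \<in> monics d"
  shows "frob_at_inf i a = node_prod k d (node i) +
    (\<Sum>j<d. frob_at_inf k a ^ (CARD('a) ^ j) * lagrange_basis k d j (node i))"
proof -
  define P :: "'a fls poly" where "P = (\<Prod>m<d. [:- node (k + m), 1:])"
  have poly_P: "poly P u = node_prod k d u" for u
    by (simp add: P_def node_prod_def poly_prod)
  have deg_P: "degree P = d"
    unfolding P_def by (subst degree_prod_eq_sum_degree) auto
  have "lead_coeff P = 1"
    unfolding P_def by (subst lead_coeff_prod) auto
  then have P: "coeff P n = (if n = d then 1 else 0)" if "n \<ge> d" for n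
    using that deg_P by (auto simp: coeff_eq_0)
  \<comment> \<open>Both polynomials are monic of degree \<open>d\<close>, so the difference can be
    interpolated at \<open>d\<close> nodes; since \<open>P\<close> vanishes there, it has the values
    of \<open>a\<close>.\<close>
  have "coeff (map_poly fls_const a - P) n = 0" if "n \<ge> d" for n
    using assms P[OF that] that by (auto simp: monics_def coeff_map_poly coeff_eq_0)
  then have "poly (map_poly fls_const a - P) (node i)
      = (\<Sum>j<d. poly (map_poly fls_const a - P) (node (k + j)) * lagrange_basis k d j (node i))"
    by (rule interpolate_at_nodes)
  moreover have "poly P (node (k + j)) = 0" if "j < d" for j
    using that by (auto simp: poly_P node_prod_def)
  ultimately have "frob_at_inf i a - node_prod k d (node i)
      = (\<Sum>j<d. frob_at_inf k a ^ (CARD('a) ^ j) * lagrange_basis k d j (node i))"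
    by (simp add: poly_map_fls_const_node frob_at_inf_add_exponent poly_P)
  then show ?thesis by (simp add: algebra_simps)
qed

section \<open>Evaluation of the power sums\<close>

lemma zero_in_frob_deg_less: "0 \<in> frob_at_inf k ` deg_less d"
  by (rule image_eqI[of _ _ 0]) (auto simp: deg_less_def)

lemma diff_in_frob_deg_less:
  assumes "v \<in> frob_at_inf k ` deg_less d" "w \<in> frob_at_inf k ` deg_less d"
  shows "v - w \<in> frob_at_inf k ` deg_less d"
proof -
  obtain a b where "a \<in> deg_less d" "b \<in> deg_less d" "v = frob_at_inf k a" "w = frob_at_inf k b"
    using assms by blast
  then show ?thesis
    by (intro image_eqI[of _ _ "a - b"]) (auto simp: deg_less_def frob_at_inf_diff)
qed

text \<open>On monic \<open>a\<close> of degree \<open>d\<close> each factor is a polynomial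
  \<open>g i\<close> in \<open>frob_at_inf k a\<close>, whose constant term is the
  \<open>node_prod\<close> value. Fewer than \<open>q\<close> factors of degree at most
  \<open>q ^ (d - 1)\<close> stay below the size \<open>q ^ d\<close> of the coset. The sum of the
  reciprocals is left unevaluated, as it will be common to both sides of the swap.\<close>

lemma sum_monics_frob:
  fixes I :: "'i set" and ks :: "'i \<Rightarrow> nat"
  assumes fin: "finite I" and card: "card I < CARD('a::{field,finite})"
  shows "(\<Sum>a\<in>monics d. (\<Prod>i\<in>I. frob_at_inf (ks i) a) / frob_at_inf k a)
    = (\<Sum>a\<in>monics d. 1 / frob_at_inf k (a :: 'a poly)) * (\<Prod>i\<in>I. node_prod k d (node (ks i)))"
proof -
  define q where "q = CARD('a)"
  have q: "q \<ge> 2" unfolding q_def by (rule two_le_CARD_field)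
  \<comment> \<open>For \<open>d = 0\<close> every \<open>g i\<close> is constant, whereas truncated
    subtraction would make the bound \<open>q ^ 0 = 1\<close>, too weak for a product of degree
    below \<open>q ^ 0\<close>.\<close>
  define B where "B = (if d = 0 then 0 else q ^ (d - 1))"
  define g :: "'i \<Rightarrow> 'a fls poly" where
    "g i = [:node_prod k d (node (ks i)):] +
      (\<Sum>j<d. monom (lagrange_basis k d j (node (ks i))) (q ^ j))" for i
  define V where "V = (frob_at_inf k :: 'a poly \<Rightarrow> _) ` deg_less d"
  have inj: "inj_on (frob_at_inf k :: 'a poly \<Rightarrow> _) A" for A
    using inj_frob_at_inf by (rule inj_on_subset) simp
  have cardV: "card V = q ^ d"
    by (simp add: V_def card_image[OF inj] card_deg_less q_def)
  have img: "(+) (frob_at_inf k (monom 1 d)) ` V = frob_at_inf k ` monics d"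
    by (simp add: V_def monics_eq_image image_image frob_at_inf_add)
  have deg_g: "degree (g i) \<le> B" for i
  proof -
    have "degree (\<Sum>j<d. monom (lagrange_basis k d j (node (ks i))) (q ^ j)) \<le> B"
    proof (rule degree_sum_le)
      fix j assume "j \<in> {..<d}"
      then have "q ^ j \<le> B" using q by (auto simp: B_def intro!: power_increasing)
      then show "degree (monom (lagrange_basis k d j (node (ks i))) (q ^ j)) \<le> B"
        using degree_monom_le order.trans by blast
    qed simp
    then show ?thesis unfolding g_def by (intro degree_add_le) auto
  qed
  have "degree (\<Prod>i\<in>I. g i) \<le> (\<Sum>i\<in>I. degree (g i))"
    using fin by (intro order.trans[OF degree_prod_sum_le]) auto
  also have "\<dots> \<le> card I * B"
    using sum_bounded_above[of I "\<lambda>i. degree (g i)" B] deg_g by simp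
  also have "\<dots> < q ^ d"
  proof (cases "d = 0")
    case False
    then have "q ^ d = q * q ^ (d - 1)" by (simp flip: power_Suc)
    with False q card show ?thesis by (simp add: B_def q_def)
  qed (simp add: B_def)
  finally have deg: "degree (\<Prod>i\<in>I. g i) < card V" by (simp add: cardV)
  have "monom 1 d \<notin> (deg_less d :: 'a poly set)" by (auto simp: deg_less_def)
  then have "frob_at_inf k (monom 1 d :: 'a poly) \<notin> V"
    using inj_frob_at_inf by (auto simp: V_def dest: injD)
  then have "(\<Sum>w\<in>frob_at_inf k ` monics d. poly (\<Prod>i\<in>I. g i) w / w)
      = (\<Sum>w\<in>(frob_at_inf k :: 'a poly \<Rightarrow> _) ` monics d. 1 / w) * poly (\<Prod>i\<in>I. g i) 0"
    unfolding img[symmetric]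
  proof (rule sum_poly_divide_coset[rotated 3])
    show "finite V" by (simp add: V_def)
    show "0 \<in> V" unfolding V_def by (rule zero_in_frob_deg_less)
    show "v - w \<in> V" if "v \<in> V" "w \<in> V" for v w
      using that unfolding V_def by (rule diff_in_frob_deg_less)
  qed (rule deg)
  moreover have "poly (\<Prod>i\<in>I. g i) (frob_at_inf k a) = (\<Prod>i\<in>I. frob_at_inf (ks i) a)"
    if "a \<in> monics d" for a :: "'a poly"
    unfolding poly_prod
  proof (intro prod.cong refl)
    show "poly (g i) (frob_at_inf k a) = frob_at_inf (ks i) a" for i
      using frob_at_inf_eq_monics[OF that, of "ks i" k]
      by (simp add: g_def poly_sum poly_monom q_def mult.commute)
  qed
  moreover have "poly (\<Prod>i\<in>I. g i) 0 = (\<Prod>i\<in>I. node_prod k d (node (ks i)))"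
    using q by (simp add: g_def poly_sum poly_monom poly_prod power_0_left)
  ultimately show ?thesis by (simp add: sum.reindex[OF inj])
qed

text \<open>The sign comes from \<open>q - 1 = -1\<close> in characteristic \<open>p\<close>.\<close>
lemma sum_nonzero_deg_less_homogeneous:
  fixes g :: "'a::{field,finite} poly \<Rightarrow> 'a fls"
  assumes hom: "\<And>c a. c \<noteq> 0 \<Longrightarrow> a \<noteq> 0 \<Longrightarrow> g (smult c a) = g a"
  shows "(\<Sum>a\<in>deg_less d - {0}. g a) = - (\<Sum>a\<in>monics_less d. g a)"
proof -
  have "of_nat (CARD('a) - 1) = (of_nat CARD('a) - 1 :: 'a)"
    using two_le_CARD_field[where ?'a = 'a] by (subst of_nat_diff) auto
  then have neg: "of_nat (CARD('a) - 1) = (- 1 :: 'a fls)"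
    by (simp add: of_nat_CARD_eq_0 fls_of_nat)
  have deg: "a \<in> deg_less d \<longleftrightarrow> degree a < d" if "a \<noteq> 0" for a :: "'a poly"
    using that leading_coeff_neq_0[OF that] by (auto simp: deg_less_def coeff_eq_0 not_less[symmetric])
  have "(\<Sum>a\<in>deg_less d - {0}. g a) = (\<Sum>(c, a)\<in>(UNIV - {0 :: 'a}) \<times> monics_less d. g a)"
  proof (rule sum.reindex_bij_witness[of _ "\<lambda>(c, a). smult c a"
        "\<lambda>a. (lead_coeff a, smult (inverse (lead_coeff a)) a)"])
    fix a :: "'a poly" assume a: "a \<in> deg_less d - {0}"
    then show "(case (lead_coeff a, smult (inverse (lead_coeff a)) a) of (c, a) \<Rightarrow> smult c a) = a"
      by simp
    show "(lead_coeff a, smult (inverse (lead_coeff a)) a) \<in> (UNIV - {0}) \<times> monics_less d"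
      using a deg[of a] by (auto simp: monics_less_def)
    show "(case (lead_coeff a, smult (inverse (lead_coeff a)) a) of (c, a) \<Rightarrow> g a) = g a"
      using a hom[of "inverse (lead_coeff a)" a] by simp
  next
    fix b :: "'a \<times> 'a poly" assume b: "b \<in> (UNIV - {0}) \<times> monics_less d"
    obtain c a where ca: "b = (c, a)" by (cases b)
    with b have "c \<noteq> 0" "a \<noteq> 0" "lead_coeff a = 1" "degree a < d" by (auto simp: monics_less_def)
    then show "(lead_coeff (case b of (c, a) \<Rightarrow> smult c a),
        smult (inverse (lead_coeff (case b of (c, a) \<Rightarrow> smult c a))) (case b of (c, a) \<Rightarrow> smult c a)) = b"
      and "(case b of (c, a) \<Rightarrow> smult c a) \<in> deg_less d - {0}"
      using deg[of "smult c a"] by (auto simp: ca)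
  qed
  also have "\<dots> = of_nat (CARD('a) - 1) * (\<Sum>a\<in>monics_less d. g a)"
    by (simp add: sum.cartesian_product[symmetric] card_Diff_singleton)
  finally show ?thesis by (simp only: neg) simp
qed

lemma sum_monics_less_frob:
  fixes J :: "'i set" and ls :: "'i \<Rightarrow> nat"
  assumes fin: "finite J" and card: "1 \<le> card J" "card J \<le> CARD('a::{field,finite})" and d: "d > 0"
  shows "(\<Sum>a\<in>monics_less d. (\<Prod>j\<in>J. frob_at_inf (ls j) a) / frob_at_inf k (a :: 'a poly) ^ card J)
    = (\<Prod>j\<in>J. lagrange_basis k d 0 (node (ls j)))"
proof -
  define q where "q = CARD('a)"
  have q: "q \<ge> 2" unfolding q_def by (rule two_le_CARD_field)
  \<comment> \<open>Each numerator factor is divided by one copy of \<open>frob_at_inf k a\<close>,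
    which lowers all exponents by one. This gain in degree is what admits
    \<open>card J = q\<close>.\<close>
  define g :: "'i \<Rightarrow> 'a fls poly" where
    "g i = (\<Sum>j<d. monom (lagrange_basis k d j (node (ls i))) (q ^ j - 1))" for i
  define G where "G a = (\<Prod>j\<in>J. frob_at_inf (ls j) a) / frob_at_inf k a ^ card J" for a :: "'a poly"
  define V where "V = (frob_at_inf k :: 'a poly \<Rightarrow> _) ` deg_less d"
  have inj: "inj_on (frob_at_inf k :: 'a poly \<Rightarrow> _) A" for A
    using inj_frob_at_inf by (rule inj_on_subset) simp
  have cardV: "card V = q ^ d"
    by (simp add: V_def card_image[OF inj] card_deg_less q_def)
  have V0: "V - {0} = frob_at_inf k ` (deg_less d - {0})"
    by (auto simp: V_def)
  have deg_g: "degree (g i) \<le> q ^ (d - 1) - 1" for i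
    unfolding g_def
  proof (rule degree_sum_le)
    fix j assume "j \<in> {..<d}"
    then have "q ^ j - 1 \<le> q ^ (d - 1) - 1" using q by (auto intro!: diff_le_mono power_increasing)
    then show "degree (monom (lagrange_basis k d j (node (ls i))) (q ^ j - 1)) \<le> q ^ (d - 1) - 1"
      using degree_monom_le order.trans by blast
  qed simp
  have "degree (\<Prod>i\<in>J. g i) \<le> (\<Sum>i\<in>J. degree (g i))"
    using fin by (intro order.trans[OF degree_prod_sum_le]) auto
  also have "\<dots> \<le> card J * (q ^ (d - 1) - 1)"
    using sum_bounded_above[of J "\<lambda>i. degree (g i)" "q ^ (d - 1) - 1"] deg_g by simp
  also have "\<dots> \<le> q * (q ^ (d - 1) - 1)"
    using card by (simp add: q_def)
  also have "\<dots> = q ^ d - q"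
    using d by (simp add: diff_mult_distrib2 flip: power_Suc)
  finally have "degree (\<Prod>i\<in>J. g i) \<le> q ^ d - q" .
  \<comment> \<open>This keeps \<open>q ^ d - q\<close> from truncating; as
    \<open>q \<ge> 2\<close>, one more than the degree is still below \<open>q ^ d\<close>.\<close>
  moreover have "q ^ 1 \<le> q ^ d" using d q by (intro power_increasing) auto
  ultimately have deg: "degree (\<Prod>i\<in>J. g i) + 1 < card V" using q unfolding cardV by simp
  have g_frob: "poly (g i) (frob_at_inf k a) = frob_at_inf (ls i) a / frob_at_inf k a"
    if a: "a \<in> deg_less d - {0}" for i and a :: "'a poly"
  proof -
    have "frob_at_inf k a * poly (g i) (frob_at_inf k a) = frob_at_inf (ls i) a"
    proof -
      have "frob_at_inf k a * poly (g i) (frob_at_inf k a)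
          = (\<Sum>j<d. lagrange_basis k d j (node (ls i)) *
              (frob_at_inf k a * frob_at_inf k a ^ (q ^ j - 1)))"
        by (simp add: g_def poly_sum poly_monom sum_distrib_left algebra_simps)
      also have "\<dots> = (\<Sum>j<d. frob_at_inf k a ^ (q ^ j) * lagrange_basis k d j (node (ls i)))"
        using q by (intro sum.cong refl) (simp flip: power_Suc)
      also have "\<dots> = frob_at_inf (ls i) a"
        using frob_at_inf_eq_deg_less[of a d "ls i" k] a by (simp add: q_def)
      finally show ?thesis .
    qed
    then show ?thesis using a by (simp add: field_simps)
  qed
  \<comment> \<open>Only the monomial for \<open>j = 0\<close> has exponent 0 and survives at
    0.\<close>
  have poly_0: "poly (g i) 0 = lagrange_basis k d 0 (node (ls i))" for i
  proof -
    have "q ^ j - 1 = 0 \<longleftrightarrow> j = 0" for j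
      using q one_less_power[of q j] by (cases "j = 0") auto
    then have "poly (g i) 0 = (\<Sum>j<d. if j = 0 then lagrange_basis k d j (node (ls i)) else 0)"
      unfolding g_def poly_sum poly_monom power_0_left by (intro sum.cong refl) simp
    then show ?thesis using d by simp
  qed
  have "(\<Sum>a\<in>deg_less d - {0}. G a) = (\<Sum>a\<in>deg_less d - {0}. poly (\<Prod>i\<in>J. g i) (frob_at_inf k a))"
    by (intro sum.cong refl) (simp add: G_def poly_prod g_frob prod_dividef)
  also have "\<dots> = (\<Sum>v\<in>V - {0}. poly (\<Prod>i\<in>J. g i) v)"
    by (simp add: V0 sum.reindex[OF inj])
  also have "\<dots> = - poly (\<Prod>i\<in>J. g i) 0"
  proof (rule sum_poly_nonzero_subgroup)
    show "finite V" by (simp add: V_def)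
    show "0 \<in> V" unfolding V_def by (rule zero_in_frob_deg_less)
    show "v - w \<in> V" if "v \<in> V" "w \<in> V" for v w
      using that unfolding V_def by (rule diff_in_frob_deg_less)
  qed (rule deg)
  finally have "(\<Sum>a\<in>deg_less d - {0}. G a) = - (\<Prod>j\<in>J. lagrange_basis k d 0 (node (ls j)))"
    by (simp add: poly_prod poly_0)
  \<comment> \<open>Numerator and denominator both have \<open>card J\<close> factors, and each
    picks up the same scalar \<open>c\<close>. The two minus signs then cancel.\<close>
  moreover have "G (smult c a) = G a" if "c \<noteq> 0" "a \<noteq> 0" for c a
    using that by (simp add: G_def frob_at_inf_smult prod.distrib power_mult_distrib)
  ultimately have "(\<Sum>a\<in>monics_less d. G a) = (\<Prod>j\<in>J. lagrange_basis k d 0 (node (ls j)))"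
    using sum_nonzero_deg_less_homogeneous[of G d] by simp
  then show ?thesis by (simp add: G_def)
qed

section \<open>Exchanging exponents in one degree\<close>

text \<open>The last product does not depend on \<open>u\<close>, so it is unaffected when the
  arguments are exchanged.\<close>

lemma node_prod_eq_lagrange_basis:
  assumes "d > 0"
  shows "node_prod k d u
    = (u - node k) * lagrange_basis k d 0 u * (\<Prod>m\<in>{..<d} - {0}. node k - node (k + m))"
proof -
  have "node k - node (k + m) \<noteq> (0 :: 'a fls)" if "m \<noteq> 0" for m
    using that inj_node[where ?'a = 'a] by (auto dest: injD)
  then have "(\<Prod>m\<in>{..<d} - {0}. node k - node (k + m)) \<noteq> (0 :: 'a fls)"
    by (simp add: prod_zero_iff)
  then have "lagrange_basis k d 0 u * (\<Prod>m\<in>{..<d} - {0}. node k - node (k + m))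
      = (\<Prod>m\<in>{..<d} - {0}. u - node (k + m))"
    by (simp add: lagrange_basis_def prod_dividef)
  moreover have "node_prod k d u = (u - node k) * (\<Prod>m\<in>{..<d} - {0}. u - node (k + m))"
    unfolding node_prod_def using assms by (subst prod.remove[of _ 0]) auto
  ultimately show ?thesis by (simp add: mult.assoc)
qed

text \<open>The part of \<open>zeta s1 s2\<close> coming from the pairs whose first entry has degree
  \<open>d\<close>.\<close>

definition depth_term :: "nat \<Rightarrow> nat \<Rightarrow> nat \<Rightarrow> 'a::{field,finite} fls" where
  "depth_term s1 s2 d =
    (\<Sum>a\<in>monics d. 1 / poly_at_inf a ^ s1) * (\<Sum>b\<in>monics_less d. 1 / poly_at_inf b ^ s2)"

lemma inverse_power_frob:
  fixes a :: "'a::{field,finite} poly"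
  assumes "a \<noteq> 0" "(\<Sum>i\<in>I. CARD('a) ^ ks i) \<le> s * CARD('a) ^ k"
  shows "1 / poly_at_inf a ^ (s * CARD('a) ^ k - (\<Sum>i\<in>I. CARD('a) ^ ks i))
    = (\<Prod>i\<in>I. frob_at_inf (ks i) a) / frob_at_inf k a ^ s"
  using assms
  by (simp add: power_diff frob_at_inf_def power_sum mult.commute[of s] power_mult)

text \<open>Both sides contain the basis values at all \<open>ks i\<close> and \<open>ls i\<close>
  with \<open>i \<in> I\<close> and at all \<open>ls j\<close> with \<open>j \<in> J - I\<close>:
  the exchange merely moves the former between the two power sums. What remains is the quotient of
  the node differences.\<close>

lemma depth_term_swap:
  fixes ks ls :: "'i \<Rightarrow> nat"
  assumes fin: "finite J" and sub: "I \<subseteq> J" "I \<noteq> {}"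
    and card: "card I < CARD('a)" "card J \<le> CARD('a::{field,finite})"
    and ls: "\<And>i. i \<in> I \<Longrightarrow> ls i < k"
    and le: "(\<Sum>i\<in>I. CARD('a) ^ ks i) \<le> CARD('a) ^ k"
      "(\<Sum>i\<in>I. CARD('a) ^ ls i) \<le> CARD('a) ^ k"
      "(\<Sum>j\<in>J. CARD('a) ^ ls j) \<le> card J * CARD('a) ^ k"
      "(\<Sum>j\<in>J. CARD('a) ^ (if j \<in> I then ks j else ls j)) \<le> card J * CARD('a) ^ k"
  shows "depth_term (CARD('a) ^ k - (\<Sum>i\<in>I. CARD('a) ^ ks i))
      (card J * CARD('a) ^ k - (\<Sum>j\<in>J. CARD('a) ^ ls j)) d
    = (\<Prod>i\<in>I. (node k - node (ks i)) / (node k - node (ls i))) *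
      (depth_term (CARD('a) ^ k - (\<Sum>i\<in>I. CARD('a) ^ ls i))
        (card J * CARD('a) ^ k - (\<Sum>j\<in>J. CARD('a) ^ (if j \<in> I then ks j else ls j))) d :: 'a fls)"
proof (cases "d = 0")
  \<comment> \<open>\<open>monics_less 0\<close> is empty, so both sides vanish.\<close>
  case True
  then show ?thesis by (simp add: depth_term_def monics_less_def)
next
  case False
  then have d: "d > 0" by simp
  define S :: "'a fls" where "S = (\<Sum>a\<in>monics d. 1 / frob_at_inf k (a :: 'a poly))"
  define M :: "'a fls" where "M = (\<Prod>m\<in>{..<d} - {0}. node k - node (k + m))"
  define L :: "nat \<Rightarrow> 'a fls" where "L i = lagrange_basis k d 0 (node i)" for i
  define ls' where "ls' j = (if j \<in> I then ks j else ls j)" for j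
  have finI: "finite I" using sub(1) fin by (rule finite_subset)
  have "J \<noteq> {}" using sub by auto
  then have cardJ: "1 \<le> card J" using fin by (simp add: Suc_le_eq card_gt_0_iff)
  have monic_nz: "a \<noteq> 0" if "a \<in> monics d \<or> a \<in> monics_less d" for a :: "'a poly"
    using that by (auto simp: monics_def monics_less_def)
  have left: "(\<Sum>a\<in>monics d. 1 / poly_at_inf (a :: 'a poly) ^ (CARD('a) ^ k - (\<Sum>i\<in>I. CARD('a) ^ m i)))
      = S * (\<Prod>i\<in>I. (node (m i) - node k) * L (m i) * M)"
    if "(\<Sum>i\<in>I. CARD('a) ^ m i) \<le> CARD('a) ^ k" for m
  proof -
    have "(\<Sum>a\<in>monics d. 1 / poly_at_inf (a :: 'a poly) ^ (CARD('a) ^ k - (\<Sum>i\<in>I. CARD('a) ^ m i)))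
        = (\<Sum>a\<in>monics d. (\<Prod>i\<in>I. frob_at_inf (m i) a) / frob_at_inf k (a :: 'a poly))"
    proof (intro sum.cong refl)
      fix a :: "'a poly" assume "a \<in> monics d"
      then show "1 / poly_at_inf a ^ (CARD('a) ^ k - (\<Sum>i\<in>I. CARD('a) ^ m i))
          = (\<Prod>i\<in>I. frob_at_inf (m i) a) / frob_at_inf k a"
        using inverse_power_frob[of a m I 1 k] monic_nz[of a] that by simp
    qed
    also have "\<dots> = S * (\<Prod>i\<in>I. node_prod k d (node (m i)))"
      unfolding S_def by (rule sum_monics_frob[OF finI card(1)])
    finally show ?thesis
      by (simp add: node_prod_eq_lagrange_basis[OF d] L_def M_def)
  qed
  have right: "(\<Sum>a\<in>monics_less d. 1 / poly_at_inf (a :: 'a poly) ^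
        (card J * CARD('a) ^ k - (\<Sum>j\<in>J. CARD('a) ^ m j))) = (\<Prod>j\<in>J. L (m j))"
    if "(\<Sum>j\<in>J. CARD('a) ^ m j) \<le> card J * CARD('a) ^ k" for m
  proof -
    have "(\<Sum>a\<in>monics_less d. 1 / poly_at_inf (a :: 'a poly) ^
          (card J * CARD('a) ^ k - (\<Sum>j\<in>J. CARD('a) ^ m j)))
        = (\<Sum>a\<in>monics_less d. (\<Prod>j\<in>J. frob_at_inf (m j) a) / frob_at_inf k (a :: 'a poly) ^ card J)"
      by (intro sum.cong refl inverse_power_frob monic_nz that disjI2)
    then show ?thesis
      unfolding L_def using sum_monics_less_frob[OF fin cardJ card(2) d] by simp
  qed
  have split: "(\<Prod>j\<in>J. L (m j)) = (\<Prod>j\<in>I. L (m j)) * (\<Prod>j\<in>J - I. L (m j))" for m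
    using prod.subset_diff[OF sub(1) fin, of "\<lambda>j. L (m j)"] by (simp add: mult.commute)
  have nz: "node k - node i \<noteq> (0 :: 'a fls)" if "i < k" for i
    using that inj_node[where ?'a = 'a] by (auto dest: injD)
  \<comment> \<open>Reversing both differences in each quotient leaves it unchanged, so no sign
    appears. The denominators are nonzero because \<open>ls i < k\<close>.\<close>
  have ratio: "(\<Prod>i\<in>I. node (ks i) - node k)
      = (\<Prod>i\<in>I. (node k - node (ks i)) / (node k - node (ls i))) * (\<Prod>i\<in>I. node (ls i) - node k :: 'a fls)"
    unfolding prod.distrib[symmetric]
  proof (intro prod.cong refl)
    fix i assume "i \<in> I"
    then have "node k - node (ls i) \<noteq> (0 :: 'a fls)" using nz ls by blast
    then show "node (ks i) - node k
        = (node k - node (ks i)) / (node k - node (ls i)) * (node (ls i) - node k :: 'a fls)"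
      by (simp add: field_simps)
  qed
  have I: "(\<Prod>j\<in>I. L (ls' j)) = (\<Prod>j\<in>I. L (ks j))"
    and JI: "(\<Prod>j\<in>J - I. L (ls' j)) = (\<Prod>j\<in>J - I. L (ls j))"
    by (auto simp: ls'_def intro!: prod.cong)
  have le': "(\<Sum>j\<in>J. CARD('a) ^ ls' j) \<le> card J * CARD('a) ^ k"
    using le(4) by (simp add: ls'_def)
  show ?thesis
    unfolding depth_term_def ls'_def[symmetric]
    unfolding left[OF le(1)] left[OF le(2)] right[OF le(3)] right[OF le'] split[of ls] split[of ls'] I JI
    by (simp add: prod.distrib ratio mult_ac)
qed

section \<open>From identities in each degree to the infinite sums\<close>

text \<open>Converse of \<open>dist_fls_less\<close>. A difference of negative subdegree is treated
  separately: its distance is at least 1.\<close>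

lemma fls_nth_eq_of_dist_less:
  fixes f g :: "'a::group_add fls"
  assumes "dist f g < inverse (2 ^ n)" "i \<le> int n"
  shows "fls_nth f i = fls_nth g i"
proof (cases "f = g")
  case False
  have "int n < fls_subdegree (f - g)"
  proof (rule ccontr)
    assume neg: "\<not> int n < fls_subdegree (f - g)"
    have "inverse (2 ^ n) \<le> dist f g"
    proof (cases "0 \<le> fls_subdegree (f - g)")
      case True
      then have "nat (fls_subdegree (f - g)) \<le> n" using neg by linarith
      then have "(2::real) ^ nat (fls_subdegree (f - g)) \<le> 2 ^ n"
        by (intro power_increasing) auto
      then show ?thesis using True False by (simp add: dist_fls_def le_imp_inverse_le)
    next
      case neg': False
      have "inverse (2 ^ n) \<le> (1::real)" by (simp add: inverse_le_1_iff)
      also have "1 \<le> (2::real) ^ nat (- fls_subdegree (f - g))" by simp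
      finally show ?thesis using neg' False by (simp add: dist_fls_def)
    qed
    with assms(1) show False by simp
  qed
  then have "fls_nth (f - g) i = 0" using assms(2) by (intro fls_eq0_below_subdegree) simp
  then show ?thesis by simp
qed simp

text \<open>By convergence, the \<open>i\<close>-th coefficient of the finite partial sums is
  eventually that of the infinite sum. A finite set beyond that stage may be enlarged by
  \<open>F\<close>, and its elements outside \<open>F\<close> contribute nothing.\<close>

lemma fls_nth_infsum:
  fixes f :: "'b \<Rightarrow> 'a::field fls"
  assumes sum: "f summable_on S" and F: "finite F" "F \<subseteq> S"
    and out: "\<And>x. x \<in> S - F \<Longrightarrow> fls_nth (f x) i = 0"
  shows "fls_nth (infsum f S) i = fls_nth (sum f F) i"
proof -
  have "(f has_sum infsum f S) S" using sum by (rule has_sum_infsum)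
  then have "\<forall>\<^sub>F G in finite_subsets_at_top S. dist (sum f G) (infsum f S) < inverse (2 ^ nat i)"
    unfolding has_sum_def by (rule tendstoD) simp
  then obtain X where X: "finite X" "X \<subseteq> S"
    "\<And>Y. finite Y \<Longrightarrow> X \<subseteq> Y \<Longrightarrow> Y \<subseteq> S \<Longrightarrow> dist (sum f Y) (infsum f S) < inverse (2 ^ nat i)"
    by (auto simp: eventually_finite_subsets_at_top)
  have "fls_nth (sum f (X \<union> F)) i = fls_nth (infsum f S) i"
    by (rule fls_nth_eq_of_dist_less[where n = "nat i"]) (use X F in auto)
  moreover have "fls_nth (sum f (X \<union> F)) i = fls_nth (sum f F) i"
    unfolding fls_nth_sum by (rule sum.mono_neutral_right) (use X F out in auto)
  ultimately show ?thesis by simp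
qed

lemma fls_nth_zeta:
  assumes s: "s1 > 0" "s2 > 0" and i: "i \<le> int D"
  shows "fls_nth (zeta s1 s2 :: 'a::{field,finite} fls) i = fls_nth (\<Sum>d\<le>D. depth_term s1 s2 d) i"
proof -
  define f :: "'a poly \<times> 'a poly \<Rightarrow> 'a fls"
    where "f = (\<lambda>(a, b). 1 / (poly_at_inf a ^ s1 * poly_at_inf b ^ s2))"
  define F :: "('a poly \<times> 'a poly) set" where "F = {x \<in> monic_pairs. degree (fst x) \<le> D}"
  have F_d: "{x \<in> F. degree (fst x) = d} = monics d \<times> monics_less d" if "d \<le> D" for d
    using that by (auto simp: F_def monic_pairs_def monics_def monics_less_def)
  have finF: "finite F"
  proof (rule finite_subset)
    show "F \<subseteq> (\<Union>d\<le>D. monics d \<times> monics_less d)"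
      by (auto simp: F_def monic_pairs_def monics_def monics_less_def)
  qed auto
  have "sum f F = (\<Sum>d\<le>D. sum f {x \<in> F. degree (fst x) = d})"
    by (rule sum.group[symmetric]) (use finF in \<open>auto simp: F_def\<close>)
  also have "\<dots> = (\<Sum>d\<le>D. depth_term s1 s2 d)"
  proof (intro sum.cong refl)
    fix d assume "d \<in> {..D}"
    then have "sum f {x \<in> F. degree (fst x) = d} = (\<Sum>(a, b)\<in>monics d \<times> monics_less d.
        1 / poly_at_inf a ^ s1 * (1 / poly_at_inf b ^ s2))"
      by (simp add: F_d f_def case_prod_unfold)
    also have "\<dots> = depth_term s1 s2 d"
      by (simp only: depth_term_def sum_product sum.cartesian_product)
    finally show "sum f {x \<in> F. degree (fst x) = d} = depth_term s1 s2 d" .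
  qed
  finally have sum_F: "sum f F = (\<Sum>d\<le>D. depth_term s1 s2 d)" .
  have "fls_nth (infsum f monic_pairs) i = fls_nth (sum f F) i"
  proof (rule fls_nth_infsum[OF _ finF])
    show "f summable_on monic_pairs" unfolding f_def by (rule zeta_summable[OF s])
    show "F \<subseteq> monic_pairs" by (auto simp: F_def)
    fix x assume x: "x \<in> monic_pairs - F"
    obtain a b where ab: "x = (a, b)" by (cases x)
    with x have nz: "a \<noteq> 0" "b \<noteq> 0" and deg: "D < degree a" by (auto simp: F_def monic_pairs_def)
    \<comment> \<open>Pairs with first degree above \<open>D\<close> have terms of subdegree above
      \<open>D\<close>, hence do not reach the coefficient \<open>i\<close>.\<close>
    have "degree a \<le> s1 * degree a" using s by simp
    then have "int D < int (s1 * degree a + s2 * degree b)" using deg by linarith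
    also have "\<dots> = fls_subdegree (f x)"
      using nz by (simp add: ab f_def fls_divide_subdegree fls_subdegree_pow fls_subdegree_poly_at_inf)
    finally show "fls_nth (f x) i = 0" using i by (intro fls_eq0_below_subdegree) simp
  qed
  then show ?thesis by (simp add: zeta_def f_def[symmetric] sum_F)
qed

text \<open>Coefficients are compared one at a time, so that only finitely many degrees
  \<open>d\<close> matter and \<open>C\<close> can be taken out of a finite sum.\<close>

lemma zeta_eqI:
  assumes s: "s1 > 0" "s2 > 0" "r1 > 0" "r2 > 0"
    and eq: "\<And>d. depth_term s1 s2 d = C * (depth_term r1 r2 d :: 'a::{field,finite} fls)"
  shows "zeta s1 s2 = C * zeta r1 r2"
proof (rule fls_eqI)
  fix i
  \<comment> \<open>Multiplication by \<open>C\<close> shifts subdegrees by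
    \<open>fls_subdegree C\<close>, so agreement up to this larger bound is required to control the
    coefficient \<open>i\<close> of the product.\<close>
  define D where "D = nat \<bar>i\<bar> + nat \<bar>fls_subdegree C\<bar>"
  define R where "R = (\<Sum>d\<le>D. depth_term r1 r2 d :: 'a fls)"
  have agree: "fls_nth (zeta r1 r2) j = fls_nth R j" if "j \<le> int D" for j
    unfolding R_def by (rule fls_nth_zeta[OF s(3,4) that])
  have "fls_nth (C * (zeta r1 r2 - R)) i = 0"
  proof (cases "C = 0 \<or> zeta r1 r2 = R")
    case False
    then have "int D < fls_subdegree (zeta r1 r2 - R)"
      by (intro fls_subdegree_greaterI) (auto simp: agree)
    moreover have "i \<le> int D + fls_subdegree C" by (simp add: D_def)
    ultimately have "i < fls_subdegree C + fls_subdegree (zeta r1 r2 - R)" by linarith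
    then show ?thesis using False by (intro fls_eq0_below_subdegree) simp
  qed auto
  then have "fls_nth (C * zeta r1 r2) i = fls_nth (C * R) i"
    by (simp add: right_diff_distrib)
  also have "C * R = (\<Sum>d\<le>D. depth_term s1 s2 d)"
    by (simp add: R_def eq sum_distrib_left)
  also have "fls_nth \<dots> i = fls_nth (zeta s1 s2) i"
    by (rule fls_nth_zeta[OF s(1,2), symmetric]) (simp add: D_def)
  finally show "fls_nth (zeta s1 s2) i = fls_nth (C * zeta r1 r2) i" by simp
qed

section \<open>The general exchange identity and its special cases\<close>

lemma zeta_swap:
  fixes ks ls :: "nat \<Rightarrow> nat" and k s1 s2 :: nat
  defines "q \<equiv> CARD('a::{field,finite})"
  assumes k: "1 \<le> k" and s: "1 \<le> s1" "s1 \<le> s2" "s2 \<le> q" "s1 \<noteq> q"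
    and ks: "\<forall>i\<in>{1..s1}. ks i < k" and ls: "\<forall>j\<in>{1..s2}. ls j < k"
  shows "(zeta (q ^ k - (\<Sum>i=1..s1. q ^ ks i)) (s2 * q ^ k - (\<Sum>j=1..s2. q ^ ls j)) :: 'a fls)
    = (\<Prod>i=1..s1. poly_at_inf (bracket (k - ks i)) ^ (q ^ ks i)
                   / poly_at_inf (bracket (k - ls i)) ^ (q ^ ls i))
      * zeta (q ^ k - (\<Sum>i=1..s1. q ^ ls i))
             (s2 * q ^ k - (\<Sum>j=1..s1. q ^ ks j) - (\<Sum>j=s1+1..s2. q ^ ls j))"
proof -
  define ls' where "ls' j = (if j \<in> {1..s1} then ks j else ls j)" for j
  have q: "2 \<le> q" unfolding q_def by (rule two_le_CARD_field)
  have s2: "1 \<le> s2" and s1: "s1 < q" using s by auto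
  have ls1: "\<forall>i\<in>{1..s1}. ls i < k" and ls'k: "\<forall>j\<in>{1..s2}. ls' j < k"
    using ks ls s by (auto simp: ls'_def)
  \<comment> \<open>These strict bounds make all four exponents positive and rule out
    truncation.\<close>
  note lt = sum_powers_less(1)[OF q k s(1) ks s1] sum_powers_less(1)[OF q k s(1) ls1 s1]
    sum_powers_less(2)[OF q k s2 ls] sum_powers_less(2)[OF q k s2 ls'k]
  have "{1..s2} = {1..s1} \<union> {s1+1..s2}" using s by auto
  then have "(\<Sum>j=1..s2. q ^ ls' j) = (\<Sum>j=1..s1. q ^ ls' j) + (\<Sum>j=s1+1..s2. q ^ ls' j)"
    by (simp add: sum.union_disjoint)
  also have "(\<Sum>j=1..s1. q ^ ls' j) = (\<Sum>j=1..s1. q ^ ks j)"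
    by (intro sum.cong) (auto simp: ls'_def)
  also have "(\<Sum>j=s1+1..s2. q ^ ls' j) = (\<Sum>j=s1+1..s2. q ^ ls j)"
    by (intro sum.cong) (auto simp: ls'_def)
  finally have sum_ls': "s2 * q ^ k - (\<Sum>j=1..s1. q ^ ks j) - (\<Sum>j=s1+1..s2. q ^ ls j)
      = s2 * q ^ k - (\<Sum>j=1..s2. q ^ ls' j)" by simp
  have C: "(\<Prod>i=1..s1. poly_at_inf (bracket (k - ks i)) ^ (q ^ ks i)
        / poly_at_inf (bracket (k - ls i)) ^ (q ^ ls i))
      = (\<Prod>i=1..s1. (node k - node (ks i)) / (node k - node (ls i)) :: 'a fls)"
    unfolding q_def
    by (intro prod.cong refl arg_cong2[where f = "(/)"] poly_at_inf_bracket_power)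
       (use ks ls1 in \<open>auto intro: less_imp_le\<close>)
  show ?thesis
    unfolding C sum_ls'
  proof (rule zeta_eqI)
    fix d
    show "depth_term (q ^ k - (\<Sum>i=1..s1. q ^ ks i)) (s2 * q ^ k - (\<Sum>j=1..s2. q ^ ls j)) d
      = (\<Prod>i=1..s1. (node k - node (ks i)) / (node k - node (ls i))) *
        (depth_term (q ^ k - (\<Sum>i=1..s1. q ^ ls i)) (s2 * q ^ k - (\<Sum>j=1..s2. q ^ ls' j)) d :: 'a fls)"
      using depth_term_swap[where ?'a = 'a and I = "{1..s1}" and J = "{1..s2}" and ks = ks and ls = ls
          and k = k and d = d] s s1 ks ls lt
      by (simp add: q_def ls'_def)
  qed (use lt in auto)
qed

theorem theorem1:
  fixes q :: nat
  assumes "q = CARD('a::{field,finite})"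
  shows
    "(\<forall>n k. 1 \<le> k \<longrightarrow>
        (zeta (q ^ (n + k) - q ^ n) (q ^ (n + k) - 1) :: 'a fls)
          = poly_at_inf (bracket k) ^ (q ^ n) / poly_at_inf (bracket (n + k))
            * zeta (q ^ (n + k) - 1) (q ^ (n + k) - q ^ n))
     \<and>
     (\<forall>k s. \<forall>ks ls :: nat \<Rightarrow> nat.
        1 \<le> k \<longrightarrow> 1 \<le> s \<longrightarrow> s < q \<longrightarrow>
        (\<forall>i\<in>{1..s}. ks i < k \<and> ls i < k) \<longrightarrow>
        (zeta (q ^ k - (\<Sum>i=1..s. q ^ ks i)) (s * q ^ k - (\<Sum>i=1..s. q ^ ls i)) :: 'a fls)
          = (\<Prod>i=1..s. poly_at_inf (bracket (k - ks i)) ^ (q ^ ks i)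
                        / poly_at_inf (bracket (k - ls i)) ^ (q ^ ls i))
            * zeta (q ^ k - (\<Sum>i=1..s. q ^ ls i)) (s * q ^ k - (\<Sum>i=1..s. q ^ ks i)))
     \<and>
     (\<forall>k s1 s2. \<forall>ks ls :: nat \<Rightarrow> nat.
        1 \<le> k \<longrightarrow> 1 \<le> s1 \<longrightarrow> s1 \<le> s2 \<longrightarrow> s2 \<le> q \<longrightarrow> s1 \<noteq> q \<longrightarrow>
        (\<forall>i\<in>{1..s1}. ks i < k) \<longrightarrow> (\<forall>j\<in>{1..s2}. ls j < k) \<longrightarrow>
        (zeta (q ^ k - (\<Sum>i=1..s1. q ^ ks i)) (s2 * q ^ k - (\<Sum>j=1..s2. q ^ ls j)) :: 'a fls)
          = (\<Prod>i=1..s1. poly_at_inf (bracket (k - ks i)) ^ (q ^ ks i)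
                         / poly_at_inf (bracket (k - ls i)) ^ (q ^ ls i))
            * zeta (q ^ k - (\<Sum>i=1..s1. q ^ ls i))
                   (s2 * q ^ k - (\<Sum>j=1..s1. q ^ ks j) - (\<Sum>j=s1+1..s2. q ^ ls j)))"
  unfolding assms
proof (intro conjI allI impI)
  \<comment> \<open>The case of single exponents \<open>n\<close> and 0, with \<open>n + k\<close>
    in place of \<open>k\<close>.\<close>
  fix n k :: nat assume "1 \<le> k"
  then show "(zeta (CARD('a) ^ (n + k) - CARD('a) ^ n) (CARD('a) ^ (n + k) - 1) :: 'a fls)
      = poly_at_inf (bracket k) ^ (CARD('a) ^ n) / poly_at_inf (bracket (n + k))
        * zeta (CARD('a) ^ (n + k) - 1) (CARD('a) ^ (n + k) - CARD('a) ^ n)"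
    using zeta_swap[where ?'a = 'a and k = "n + k" and ?s1.0 = 1 and ?s2.0 = 1
        and ks = "\<lambda>_. n" and ls = "\<lambda>_. 0"] two_le_CARD_field[where ?'a = 'a]
    by simp
next
  \<comment> \<open>For \<open>s1 = s2 = s\<close> the trailing sum over \<open>s + 1..s\<close> is
    empty.\<close>
  fix k s :: nat and ks ls :: "nat \<Rightarrow> nat"
  assume "1 \<le> k" "1 \<le> s" "s < CARD('a)" "\<forall>i\<in>{1..s}. ks i < k \<and> ls i < k"
  then show "(zeta (CARD('a) ^ k - (\<Sum>i=1..s. CARD('a) ^ ks i))
        (s * CARD('a) ^ k - (\<Sum>i=1..s. CARD('a) ^ ls i)) :: 'a fls)
      = (\<Prod>i=1..s. poly_at_inf (bracket (k - ks i)) ^ (CARD('a) ^ ks i)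
                    / poly_at_inf (bracket (k - ls i)) ^ (CARD('a) ^ ls i))
        * zeta (CARD('a) ^ k - (\<Sum>i=1..s. CARD('a) ^ ls i))
            (s * CARD('a) ^ k - (\<Sum>i=1..s. CARD('a) ^ ks i))"
    using zeta_swap[where ?'a = 'a and k = k and ?s1.0 = s and ?s2.0 = s and ks = ks and ls = ls]
    by simp
qed (rule zeta_swap)

end
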